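(* For every real number $a$, every positive integer $m$, every integer $n\ge 0$ and every real number $x$, $$\widetilde{F}_{m,a}(n;x)=\int_{0}^{\infty}\widetilde{D}_{m,a}(n;x\lambda)\,e^{-\lambda}\,d\lambda.$$
   Context: For a real number $a$, a positive integer $m$ and integers $n,k\ge 0$, the noncentral Whitney numbers of the second kind are given by $$\widetilde{W}_{m,a}(n,k)=\frac{1}{m^k k!}\sum_{j=0}^{k}\binom{k}{j}(-1)^{k-j}(mj-a)^n,$$ with the convention $0^0=1$. The noncentral Tanny-Dowling polynomials are $$\widetilde{F}_{m,a}(n;x)=\sum_{k=0}^{n}k!\,\widetilde{W}_{m,a}(n,k)\,x^k,$$ and the noncentral Dowling polynomials are $$\widetilde{D}_{m,a}(n;x)=\sum_{k=0}^{n}\widetilde{W}_{m,a}(n,k)\,x^k.$$ *)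

theory Defs
  imports "HOL-Analysis.Analysis"
begin

(* The convention 0^0 = 1 is the one of the library's (^) with exponent of type nat. *)
definition noncentral_whitney2 :: "nat \<Rightarrow> real \<Rightarrow> nat \<Rightarrow> nat \<Rightarrow> real" where
  "noncentral_whitney2 m a n k =
     1 / (real m ^ k * fact k) *
     (\<Sum>j=0..k. real (k choose j) * (-1) ^ (k - j) * (real m * real j - a) ^ n)"

definition noncentral_tanny_dowling :: "nat \<Rightarrow> real \<Rightarrow> nat \<Rightarrow> real \<Rightarrow> real" where
  "noncentral_tanny_dowling m a n x =
     (\<Sum>k=0..n. fact k * noncentral_whitney2 m a n k * x ^ k)"

definition noncentral_dowling :: "nat \<Rightarrow> real \<Rightarrow> nat \<Rightarrow> real \<Rightarrow> real" where
  "noncentral_dowling m a n x =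
     (\<Sum>k=0..n. noncentral_whitney2 m a n k * x ^ k)"

end

theory Submission
  imports Defs "HOL-Probability.Sinc_Integral"
begin

text \<open>Euler's integral of t^k * exp (- t) over t \<ge> 0 equals k!. Since (x * t)^k = x^k *
  t^k, integrating the Dowling polynomial against exp (- t) termwise multiplies its k-th coefficient
  by k!, which gives the Tanny-Dowling polynomial. The sum is finite, so linearity suffices.\<close>

theorem theorem5:
  fixes a x :: real and m n :: nat
  assumes "m > 0"
  shows "set_integrable lborel {0..} (\<lambda>t. noncentral_dowling m a n (x * t) * exp (- t)) \<and>
    noncentral_tanny_dowling m a n x =
      (LBINT t:{0..}. noncentral_dowling m a n (x * t) * exp (- t))"
proof -
  let ?W = "noncentral_whitney2 m a n"
  \<comment> \<open>\<open>has_bochner_integral\<close> records integrability and value at once, so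
    both conjuncts follow from this one fact. The indicator sits in each summand to match Euler's
    integral.\<close>
  have "has_bochner_integral lborel
      (\<lambda>t. \<Sum>k=0..n. (?W k * x ^ k) * (t ^ k * exp (- t) * indicator {0..} t))
      (\<Sum>k=0..n. (?W k * x ^ k) * fact k)"
    by (intro has_bochner_integral_sum has_bochner_integral_mult_right
        has_bochner_integral_I0i_power_exp_m')
  \<comment> \<open>Pulling the indicator out as a scalar gives the form to which the set integral
    unfolds.\<close>
  moreover have "(\<lambda>t. \<Sum>k=0..n. (?W k * x ^ k) * (t ^ k * exp (- t) * indicator {0..} t)) =
      (\<lambda>t. indicator {0..} t *\<^sub>R (noncentral_dowling m a n (x * t) * exp (- t)))"
    by (simp add: noncentral_dowling_def sum_distrib_left sum_distrib_right power_mult_distrib mult_ac)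
  moreover have "(\<Sum>k=0..n. (?W k * x ^ k) * fact k) = noncentral_tanny_dowling m a n x"
    by (simp add: noncentral_tanny_dowling_def mult_ac)
  ultimately show ?thesis
    by (simp add: has_bochner_integral_iff set_integrable_def set_lebesgue_integral_def)
qed

end
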